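(* Let $n\in\mathbb{N}_0$, let $p=\sum_{i=0}^n c_i y^i\in\mathbb{R}[y]$ be a real polynomial of degree at most $n$, and let $f:\mathbb{R}_{>0}\to\mathbb{R}$, $f(x)=\frac{p(\log x)}{x}$. Write $c=(c_0,\ldots,c_n)^T$ and $Y=(1,y,\ldots,y^n)^T$, and let $A\in\mathbb{R}^{(n+1)\times(n+1)}$ be the invertible upper triangular matrix defined in the context. Then $f$ is completely monotone if and only if the polynomial $Y^TA^{-1}c=\sum_{k=0}^n (A^{-1}c)_k\,y^k$ lies in $\mathrm{Psd}_{1,n}=\Sigma_{1,n}$.
   Context: A smooth function $f:\mathbb{R}_{>0}\to\mathbb{R}$ is completely monotone if $\left(-\frac{d}{dx}\right)^{k}f(x)\ge 0$ for all $k\in\mathbb{N}_0$ and all $x>0$. $\mathrm{Psd}_{1,n}$ is the set of real univariate polynomials in $y$ of degree at most $n$ that are non-negative on all of $\mathbb{R}$; $\Sigma_{1,n}$ is the set of real univariate polynomials of degree at most $n$ that are finite sums of squares of real polynomials. These two sets coincide. For $l\in\mathbb{N}_0$ put $g_l:=\left.\left(\frac{d}{dz}\right)^l\Gamma(z)\right|_{z=1}$, where $\Gamma(z)=\int_0^\infty t^{z-1}e^{-t}\,dt$. The matrix $A=(A_{m,k})_{0\le m,k\le n}$ is defined by $A_{m,k}=(-1)^m\binom{k}{m}g_{k-m}$ if $k\ge m$ and $A_{m,k}=0$ otherwise (it is triangular with diagonal entries $\pm1$, hence invertible). *)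

theory Defs
  imports
    "HOL-Analysis.Analysis"
    "Jordan_Normal_Form.Gauss_Jordan_Elimination"
    "Jordan_Normal_Form.Determinant"
begin

unbundle no vec_syntax

text \<open>
  A function on the positive reals is a total function on the reals whose values outside
  the positive reals are irrelevant: since the positive reals are open, neither
  differentiability nor the iterated derivatives at \<open>x > 0\<close> depend on those values.
  The first conjunct is smoothness; it is what makes the values of \<^const>\<open>deriv\<close> meaningful.
\<close>

definition completely_monotone :: "(real \<Rightarrow> real) \<Rightarrow> bool" where
  "completely_monotone f \<longleftrightarrow>
     (\<forall>k. (deriv ^^ k) f differentiable_on {0<..}) \<and>
     (\<forall>k. \<forall>x>0. (- 1) ^ k * (deriv ^^ k) f x \<ge> 0)"

definition Psd :: "nat \<Rightarrow> real poly set" where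
  "Psd n = {p. degree p \<le> n \<and> (\<forall>y. poly p y \<ge> 0)}"

definition SOS :: "nat \<Rightarrow> real poly set" where
  "SOS n = {p. degree p \<le> n \<and> (\<exists>qs. p = (\<Sum>q\<leftarrow>qs. q ^ 2))}"

definition Gamma_deriv :: "nat \<Rightarrow> real" where
  "Gamma_deriv l = (deriv ^^ l) Gamma 1"

definition A_mat :: "nat \<Rightarrow> real mat" where
  "A_mat n = mat (n + 1) (n + 1)
     (\<lambda>(m, k). if m \<le> k then (- 1) ^ m * real (k choose m) * Gamma_deriv (k - m) else 0)"

definition coeff_vec :: "nat \<Rightarrow> real poly \<Rightarrow> real Matrix.vec" where
  "coeff_vec n p = Matrix.vec (n + 1) (coeff p)"

definition vec_poly :: "nat \<Rightarrow> real Matrix.vec \<Rightarrow> real poly" where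
  "vec_poly n v = (\<Sum>k\<le>n. monom (v $ k) k)"

text \<open>
  \<^const>\<open>mat_inverse\<close> returns an option; the lemmas below show that for \<open>A_mat n\<close> it
  yields the two-sided inverse.
\<close>

definition A_inv :: "nat \<Rightarrow> real mat" where
  "A_inv n = the (mat_inverse (A_mat n))"

lemma A_mat_carrier: "A_mat n \<in> carrier_mat (n + 1) (n + 1)"
  by (simp add: A_mat_def)

lemma A_mat_upper_triangular: "upper_triangular (A_mat n)"
  by (rule upper_triangularI) (auto simp: A_mat_def)

lemma A_mat_diag: "m \<le> n \<Longrightarrow> A_mat n $$ (m, m) = (- 1) ^ m"
  by (simp add: A_mat_def Gamma_deriv_def)

lemma det_A_mat: "Determinant.det (A_mat n) \<noteq> 0"
proof -
  have "0 \<notin> set (diag_mat (A_mat n))"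
    using A_mat_carrier[of n] by (auto simp: diag_mat_def A_mat_diag)
  then show ?thesis
    unfolding det_upper_triangular[OF A_mat_upper_triangular A_mat_carrier]
    by (simp add: prod_list_zero_iff)
qed

lemma A_inv:
  "A_inv n \<in> carrier_mat (n + 1) (n + 1)"
  "A_mat n * A_inv n = 1\<^sub>m (n + 1)"
  "A_inv n * A_mat n = 1\<^sub>m (n + 1)"
proof -
  obtain B where B: "mat_inverse (A_mat n) = Some B"
    using mat_inverse(1)[OF A_mat_carrier[of n], where b = "()"]
      det_non_zero_imp_unit[OF A_mat_carrier[of n] det_A_mat[of n], where b = "()"]
    by (cases "mat_inverse (A_mat n)") auto
  from mat_inverse(2)[OF A_mat_carrier B] B
  show "A_inv n \<in> carrier_mat (n + 1) (n + 1)"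
    "A_mat n * A_inv n = 1\<^sub>m (n + 1)" "A_inv n * A_mat n = 1\<^sub>m (n + 1)"
    by (simp_all add: A_inv_def)
qed

end

theory Submission
  imports Defs
begin

text \<open>
  Let \<open>D = d/dy\<close> and \<open>P(y) = p(-y)\<close>. Then \<open>(-1)^k f^(k)(x) = k! R_k(-log x) / x^(k+1)\<close> with
  \<open>R_k = (1 + D/1) \<dots> (1 + D/k) P\<close>, so \<open>f\<close> is completely monotone iff all \<open>R_k\<close> are non-negative.
  The matrix \<open>A\<close> encodes \<open>P = \<Gamma>(1 + D) q\<close>, where \<open>q\<close> has the coefficients \<open>A^(-1) c\<close>, and Euler's
  product says that \<open>N^(-D) (1 + D/1) \<dots> (1 + D/N) \<rightarrow> 1/\<Gamma>(1 + D)\<close> coefficientwise as formal power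
  series in \<open>D\<close>. Since \<open>N^(-D)\<close> is a translation, \<open>q(y)\<close> is the limit of \<open>R_N(y - log N)\<close>, which
  gives one direction. Conversely \<open>R_k\<close> is the limit of the polynomials
  \<open>N^D (1 + D/(k+1))^(-1) \<dots> (1 + D/N)^(-1) q\<close>, and \<open>(1 + D/j)^(-1)\<close> preserves non-negativity.
  Non-negative polynomials are sums of squares by subtracting the minimum and dividing by the
  square of the corresponding linear factor.
\<close>

section \<open>Non-negative univariate polynomials\<close>

text \<open>A non-constant polynomial is large in modulus outside some ball, where non-negativity
  makes it at least its value at 0; compactness handles the ball.\<close>

lemma poly_attains_min:
  fixes p :: "real poly"
  assumes nonneg: "\<And>y. poly p y \<ge> 0"
  obtains a where "\<And>y. poly p a \<le> poly p y"
proof (cases "degree p = 0")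
  case True
  then obtain c where "p = [:c:]" by (rule degree_eq_zeroE)
  then show ?thesis using that by auto
next
  case False
  then have "\<exists>k. k \<noteq> 0 \<and> k \<le> degree p \<and> coeff p k \<noteq> 0"
    by (intro exI[of _ "degree p"]) auto
  from polyfun_extremal[OF this, of "poly p 0"]
  obtain M where M: "\<And>z. norm z \<ge> M \<Longrightarrow> poly p 0 \<le> norm (poly p z)"
    by (auto simp: eventually_at_infinity poly_altdef)
  obtain a where a: "a \<in> cball 0 \<bar>M\<bar>" "\<And>y. y \<in> cball 0 \<bar>M\<bar> \<Longrightarrow> poly p a \<le> poly p y"
    using continuous_attains_inf[of "cball 0 \<bar>M\<bar>" "poly p"] continuous_on_poly[OF continuous_on_id]
    by force
  show ?thesis
  proof (rule that)
    fix y
    show "poly p a \<le> poly p y"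
    proof (cases "y \<in> cball 0 \<bar>M\<bar>")
      case False
      then have "poly p 0 \<le> poly p y"
        using M[of y] nonneg[of y] by (simp add: dist_norm)
      then show ?thesis using a(2)[of 0] by simp
    qed (rule a(2))
  qed
qed

lemma nonneg_poly_imp_sum_squares:
  fixes p :: "real poly"
  assumes "\<And>y. poly p y \<ge> 0"
  shows "\<exists>qs. p = (\<Sum>q\<leftarrow>qs. q ^ 2)"
  using assms
proof (induction "degree p" arbitrary: p rule: less_induct)
  case less
  obtain a where a: "\<And>y. poly p a \<le> poly p y"
    using poly_attains_min[OF less.prems] by blast
  define m where "m = poly p a"
  have m: "m = (sqrt m)^2" using less.prems by (simp add: m_def)
  have "poly (p - [:m:]) a = 0" by (simp add: m_def)
  then obtain s where s: "p - [:m:] = [:-a, 1:] * s"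
    using poly_eq_0_iff_dvd by (blast elim: dvdE)
  \<comment> \<open>The derivative vanishes at the minimum, so the cofactor \<open>s\<close> also
    vanishes at \<open>a\<close> and the root is double.\<close>
  have "poly (pderiv p) a = 0"
    by (rule DERIV_local_min[OF poly_DERIV, of 1]) (use a in auto)
  moreover have "pderiv p = pderiv (p - [:m:])" by (simp add: pderiv_diff pderiv_pCons)
  then have "pderiv p = [:-a, 1:] * pderiv s + s * pderiv [:-a, 1:]"
    unfolding s by (simp only: pderiv_mult)
  ultimately have "poly s a = 0" by (simp add: pderiv_pCons)
  then obtain r where r: "s = [:-a, 1:] * r"
    using poly_eq_0_iff_dvd by (blast elim: dvdE)
  have p: "p = [:-a, 1:]^2 * r + [:m:]"
    using s unfolding r by (simp only: power2_eq_square mult.assoc diff_eq_eq)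
  show ?case
  proof (cases "r = 0")
    case True
    with p m have "p = [:sqrt m:]^2" by (simp add: power2_eq_square)
    then have "p = (\<Sum>q\<leftarrow>[[:sqrt m:]]. q ^ 2)" by simp
    then show ?thesis by blast
  next
    case False
    have off: "poly r y \<ge> 0" if "y \<noteq> a" for y
    proof -
      have "(y - a)^2 * poly r y \<ge> 0"
        using a[of y] arg_cong[OF p, of "\<lambda>p. poly p y"] by (simp add: m_def)
      then show ?thesis using that by (simp add: zero_le_mult_iff)
    qed
    \<comment> \<open>Division by the square says nothing at \<open>a\<close> itself; continuity of
      \<open>r\<close> closes this gap.\<close>
    have "poly r y \<ge> 0" for y
    proof (cases "y = a")
      case True
      have "(poly r \<longlongrightarrow> poly r a) (at a)"
        using DERIV_isCont[OF poly_DERIV] by (simp add: isCont_def)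
      then have "poly r a \<ge> 0"
        by (rule tendsto_lowerbound) (auto simp: eventually_at_filter off)
      then show ?thesis using True by simp
    qed (rule off)
    moreover have "degree ([:-a, 1:]^2 * r) = 2 + degree r"
      using False by (subst degree_mult_eq) (auto simp: degree_power_eq)
    then have "degree r < degree p"
      unfolding p by (subst degree_add_eq_left) auto
    ultimately obtain qs where qs: "r = (\<Sum>q\<leftarrow>qs. q ^ 2)"
      using less.hyps by blast
    have "(\<Sum>q\<leftarrow>map (\<lambda>q. [:-a, 1:] * q) qs. q ^ 2) = [:-a, 1:]^2 * r"
      unfolding map_map o_def power_mult_distrib sum_list_const_mult qs ..
    moreover have "[:sqrt m:]^2 = [:m:]"
      by (subst (2) m) (simp add: power2_eq_square)
    ultimately have "p = (\<Sum>q\<leftarrow>[:sqrt m:] # map (\<lambda>q. [:-a, 1:] * q) qs. q ^ 2)"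
      by (simp only: list.map sum_list.Cons p add.commute)
    then show ?thesis by blast
  qed
qed

lemma Psd_eq_SOS: "Psd n = SOS n"
proof -
  have "poly (\<Sum>q\<leftarrow>qs. q ^ 2) y \<ge> 0" for qs :: "real poly list" and y
    by (induction qs) auto
  then show ?thesis
    using nonneg_poly_imp_sum_squares by (fastforce simp: Psd_def SOS_def)
qed

section \<open>Non-negativity under the inverse of 1 + c D\<close>

lemma poly_div_exp_tendsto_0:
  fixes w :: "real poly"
  assumes "c > 0"
  shows "((\<lambda>t. poly w t / exp (c * t)) \<longlongrightarrow> 0) at_top"
proof -
  have "((\<lambda>t. \<Sum>i\<le>degree w. coeff w i / c ^ i * ((c * t) ^ i / exp (c * t))) \<longlongrightarrow>
      (\<Sum>i\<le>degree w. coeff w i / c ^ i * 0)) at_top"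
    by (intro tendsto_sum tendsto_mult tendsto_const filterlim_compose[OF tendsto_power_div_exp_0]
        filterlim_tendsto_pos_mult_at_top[OF tendsto_const \<open>c > 0\<close>] filterlim_ident)
  then show ?thesis
    using \<open>c > 0\<close> by (simp add: poly_altdef sum_divide_distrib power_mult_distrib)
qed

text \<open>The function \<open>v(y) exp(y/c)\<close> is increasing and vanishes at \<open>-\<infinity>\<close>.\<close>

lemma nonneg_if_add_pderiv_nonneg:
  fixes v :: "real poly"
  assumes "c > 0" and nonneg: "\<And>y. poly (v + Polynomial.smult c (pderiv v)) y \<ge> 0"
  shows "poly v y \<ge> 0"
proof -
  let ?h = "\<lambda>y. poly v y * exp (y / c)"
  have deriv: "(?h has_real_derivative poly (v + Polynomial.smult c (pderiv v)) y * exp (y / c) / c) (at y)" for y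
    using \<open>c > 0\<close> by (auto intro!: derivative_eq_intros simp: field_simps)
  have mono: "?h z \<le> ?h y" if "z \<le> y" for z y
    by (rule DERIV_nonneg_imp_nondecreasing[OF that])
      (use deriv nonneg \<open>c > 0\<close> in \<open>fastforce intro!: divide_nonneg_pos\<close>)
  \<comment> \<open>Reflecting \<open>v\<close> turns its decay at minus infinity into a limit at
    plus infinity.\<close>
  have "((\<lambda>t. poly (pcompose v [:0, -1:]) t / exp (1 / c * t)) \<longlongrightarrow> 0) at_top"
    using \<open>c > 0\<close> by (intro poly_div_exp_tendsto_0) simp
  then have "((\<lambda>t. ?h (- t)) \<longlongrightarrow> 0) at_top"
    by (simp add: poly_pcompose exp_minus field_simps)
  moreover have "eventually (\<lambda>t. ?h (- t) \<le> ?h y) at_top"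
    using eventually_ge_at_top[of "- y"] by eventually_elim (rule mono, simp)
  ultimately have "0 \<le> ?h y" by (intro tendsto_upperbound) auto
  then show ?thesis by (simp add: zero_le_mult_iff)
qed

section \<open>Power series in the derivative acting on polynomials\<close>

text \<open>The operator F(D), where D is differentiation. Derivatives beyond the degree vanish, so
  the truncated sum is the whole series applied to \<open>u\<close>.\<close>

definition fps_pderiv :: "'a::field_char_0 fps \<Rightarrow> 'a poly \<Rightarrow> 'a poly" where
  "fps_pderiv F u = (\<Sum>l\<le>degree u. Polynomial.smult (fps_nth F l) ((pderiv ^^ l) u))"

lemma higher_pderiv_eq_0:
  fixes u :: "'a::field_char_0 poly"
  assumes "degree u < l"
  shows "(pderiv ^^ l) u = 0"
  using assms by (intro poly_eqI) (simp add: coeff_higher_pderiv coeff_eq_0)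

lemma fps_pderiv_altdef:
  assumes "degree u \<le> n"
  shows "fps_pderiv F u = (\<Sum>l\<le>n. Polynomial.smult (fps_nth F l) ((pderiv ^^ l) u))"
  unfolding fps_pderiv_def
  by (rule sum.mono_neutral_left) (use assms in \<open>auto simp: higher_pderiv_eq_0\<close>)

lemma degree_fps_pderiv_le: "degree (fps_pderiv F u) \<le> degree u"
  unfolding fps_pderiv_def
  by (intro degree_sum_le) (auto simp: degree_higher_pderiv intro: order.trans[OF degree_smult_le])

lemma smult_sum_right: "Polynomial.smult c (sum f A) = (\<Sum>x\<in>A. Polynomial.smult c (f x))"
  by (induction A rule: infinite_finite_induct) (simp_all add: smult_add_right)

text \<open>Composing operators amounts to taking Cauchy products, so operator identities become
  identities in a commutative ring of power series.\<close>

lemma fps_pderiv_mult: "fps_pderiv (F * G) u = fps_pderiv F (fps_pderiv G u)"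
proof -
  define n where "n = degree u"
  let ?g = "\<lambda>i j. Polynomial.smult (fps_nth F i * fps_nth G j) ((pderiv ^^ (i + j)) u)"
  have "fps_pderiv F (fps_pderiv G u) = (\<Sum>i\<le>n. \<Sum>j\<le>n. ?g i j)"
    unfolding fps_pderiv_altdef[OF degree_fps_pderiv_le[of G u], folded n_def]
    by (simp add: fps_pderiv_def n_def higher_pderiv_sum higher_pderiv_smult funpow_add smult_sum_right)
  also have "\<dots> = (\<Sum>(i, j)\<in>{..n} \<times> {..n}. ?g i j)"
    by (rule sum.cartesian_product)
  \<comment> \<open>Outside the triangle the order of the derivative exceeds the degree.\<close>
  also have "\<dots> = (\<Sum>(i, j)\<in>{(i, j). i + j \<le> n}. ?g i j)"
    by (rule sum.mono_neutral_right) (auto simp: n_def, meson higher_pderiv_eq_0 not_le)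
  also have "\<dots> = (\<Sum>l\<le>n. \<Sum>i\<le>l. ?g i (l - i))"
    by (rule sum.triangle_reindex_eq)
  also have "\<dots> = (\<Sum>l\<le>n. Polynomial.smult (fps_nth (F * G) l) ((pderiv ^^ l) u))"
    by (intro sum.cong refl) (simp add: fps_mult_nth smult_sum atLeast0AtMost)
  also have "\<dots> = fps_pderiv (F * G) u"
    by (simp add: fps_pderiv_def n_def)
  finally show ?thesis ..
qed

lemma fps_pderiv_1 [simp]: "fps_pderiv 1 u = u"
proof -
  have "fps_pderiv 1 u = (\<Sum>l\<le>degree u. if l = 0 then u else 0)"
    unfolding fps_pderiv_def by (intro sum.cong) auto
  then show ?thesis by simp
qed

lemma fps_pderiv_linear:
  "fps_pderiv (1 + fps_const c * fps_X) u = u + Polynomial.smult c (pderiv u)"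
proof -
  have "fps_pderiv (1 + fps_const c * fps_X) u =
      (\<Sum>l\<le>Suc (degree u). Polynomial.smult (fps_nth (1 + fps_const c * fps_X) l) ((pderiv ^^ l) u))"
    by (rule fps_pderiv_altdef) simp
  also have "\<dots> = (\<Sum>l\<in>{0, 1}. Polynomial.smult (fps_nth (1 + fps_const c * fps_X) l) ((pderiv ^^ l) u))"
    by (rule sum.mono_neutral_right) auto
  finally show ?thesis by simp
qed

text \<open>Taylor's formula: exp(aD) is translation by \<open>a\<close>.\<close>

lemma poly_fps_pderiv_exp:
  fixes u :: "real poly"
  shows "poly (fps_pderiv (fps_exp a) u) y = poly u (y + a)"
proof -
  let ?diff = "\<lambda>m x. poly ((pderiv ^^ m) u) (y + x)"
  have "\<forall>m x. DERIV (?diff m) x :> ?diff (Suc m) x"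
    by (auto intro!: derivative_eq_intros)
  \<comment> \<open>At this order the remainder contains a vanishing derivative, so the expansion is
    exact.\<close>
  from Maclaurin_all_le[OF refl this, of a "Suc (degree u)"]
  have "poly u (y + a) = (\<Sum>m\<le>degree u. poly ((pderiv ^^ m) u) y / fact m * a ^ m)"
    by (auto simp: higher_pderiv_eq_0 lessThan_Suc_atMost simp del: funpow.simps)
  then show ?thesis
    by (simp add: fps_pderiv_def poly_sum mult_ac)
qed

lemma tendsto_poly_fps_pderiv:
  fixes G :: "real fps"
  assumes "\<And>l. (\<lambda>N. fps_nth (F N) l) \<longlonglongrightarrow> fps_nth G l"
  shows "(\<lambda>N. poly (fps_pderiv (F N) u) y) \<longlonglongrightarrow> poly (fps_pderiv G u) y"
  unfolding fps_pderiv_def poly_sum poly_smult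
  by (intro tendsto_intros assms)

text \<open>The equation F' = F K expresses each coefficient of F beyond the constant one through
  lower coefficients of F and coefficients of K, so convergence propagates by strong
  induction.\<close>

lemma fps_tendsto_if_log_deriv_tendsto:
  fixes B :: "real fps"
  assumes A: "\<And>N. fps_deriv (A N) = A N * L N" "\<And>N. fps_nth (A N) 0 = 1"
    and B: "fps_deriv B = B * M" "fps_nth B 0 = 1"
    and lim: "\<And>i. (\<lambda>N. fps_nth (L N) i) \<longlonglongrightarrow> fps_nth M i"
  shows "(\<lambda>N. fps_nth (A N) i) \<longlonglongrightarrow> fps_nth B i"
proof (induction i rule: less_induct)
  case (less i)
  show ?case
  proof (cases i)
    case 0
    then show ?thesis by (simp add: A B)
  next
    case (Suc l)
    have coeff: "fps_nth F i = (\<Sum>j\<le>l. fps_nth F j * fps_nth K (l - j)) / real i"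
      if "fps_deriv F = F * K" for F K :: "real fps"
      using arg_cong[OF that, of "\<lambda>F. fps_nth F l"]
      by (simp add: Suc fps_mult_nth atLeast0AtMost field_simps)
    show ?thesis
      unfolding coeff[OF A(1)] coeff[OF B(1)]
      by (intro tendsto_intros less.IH lim) (auto simp: Suc)
  qed
qed

section \<open>Derivatives of the Gamma function\<close>

text \<open>Leibniz's rule applied to f' = f * \<open>G 0\<close>, where \<open>G i\<close> is the
  i-th derivative of \<open>G 0\<close>. The induction carries differentiability along with the
  formula.\<close>

lemma higher_deriv_log_deriv:
  fixes f :: "real \<Rightarrow> real"
  assumes "open S"
    and f: "\<And>x. x \<in> S \<Longrightarrow> (f has_real_derivative f x * G 0 x) (at x)"
    and G: "\<And>i x. x \<in> S \<Longrightarrow> (G i has_real_derivative G (Suc i) x) (at x)"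
    and "x \<in> S"
  shows "(deriv ^^ Suc l) f x = (\<Sum>i\<le>l. real (l choose i) * ((deriv ^^ (l - i)) f x * G i x))"
proof -
  let ?D = "\<lambda>l. (deriv ^^ l) f"
  let ?R = "\<lambda>l x. \<Sum>i\<le>l. real (l choose i) * (?D (l - i) x * G i x)"
  have "\<forall>x\<in>S. (?D l has_real_derivative ?R l x) (at x)" for l
  proof (induction l rule: less_induct)
    case (less l)
    show ?case
    proof (cases l)
      case 0
      then show ?thesis using f by simp
    next
      case (Suc m)
      have D: "?D (Suc k) x = ?R k x" "(?D k has_real_derivative ?D (Suc k) x) (at x)"
        if "k \<le> m" "x \<in> S" for k x
        using less[of k] that Suc by (auto simp: DERIV_imp_deriv)
      show ?thesis
      proof
        fix x assume x: "x \<in> S"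
        have "(?R m has_real_derivative
            (\<Sum>i\<le>m. real (m choose i) * (?D (Suc (m - i)) x * G i x + G (Suc i) x * ?D (m - i) x))) (at x)"
          by (intro DERIV_sum DERIV_cmult DERIV_mult D G x) simp
        also have "(\<Sum>i\<le>m. real (m choose i) * (?D (Suc (m - i)) x * G i x + G (Suc i) x * ?D (m - i) x)) =
            (\<Sum>i\<le>m. real (m choose i) * (?D (Suc m - i) x * G i x))
            + (\<Sum>i\<le>m. real (m choose i) * (?D (m - i) x * G (Suc i) x))"
          unfolding sum.distrib[symmetric]
          by (intro sum.cong) (auto simp: Suc_diff_le algebra_simps simp del: funpow.simps)
        \<comment> \<open>The new term has the factor \<open>m choose Suc m\<close>, which is 0.
          Splitting off i = 0 then aligns both sums for Pascal's rule.\<close>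
        also have "(\<Sum>i\<le>m. real (m choose i) * (?D (Suc m - i) x * G i x)) =
            (\<Sum>i\<le>Suc m. real (m choose i) * (?D (Suc m - i) x * G i x))"
          by simp
        also have "\<dots> = ?D (Suc m) x * G 0 x
            + (\<Sum>i\<le>m. real (m choose Suc i) * (?D (m - i) x * G (Suc i) x))"
          by (subst sum.atMost_Suc_shift) (simp del: funpow.simps)
        also have "\<dots> + (\<Sum>i\<le>m. real (m choose i) * (?D (m - i) x * G (Suc i) x)) = ?R l x"
          unfolding Suc by (subst sum.atMost_Suc_shift)
            (simp add: sum.distrib algebra_simps del: funpow.simps)
        finally have "(?R m has_real_derivative ?R l x) (at x)" .
        then show "(?D l has_real_derivative ?R l x) (at x)"
          unfolding Suc
          by (rule has_field_derivative_transform_within_open[OF _ \<open>open S\<close> x])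
            (rule D(1)[symmetric], simp)
      qed
    qed
  qed
  then show ?thesis
    using \<open>x \<in> S\<close> by (auto simp: DERIV_imp_deriv)
qed

lemma Gamma_deriv_Suc:
  "Gamma_deriv (Suc l) = (\<Sum>i\<le>l. real (l choose i) * (Gamma_deriv (l - i) * Polygamma i 1))"
  unfolding Gamma_deriv_def
proof (rule higher_deriv_log_deriv[of "{0<..}"])
  fix x :: real assume "x \<in> {0<..}"
  then have "x \<notin> \<int>\<^sub>\<le>\<^sub>0" by (auto elim!: nonpos_Ints_cases)
  then show "(Gamma has_real_derivative Gamma x * Polygamma 0 x) (at x)"
    and "(Polygamma i has_real_derivative Polygamma (Suc i) x) (at x)" for i
    by (auto intro!: derivative_intros)
qed auto

text \<open>The Taylor series of \<open>\<Gamma>(1 + s)\<close> and \<open>\<psi>(1 + s)\<close>.\<close>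

definition Gamma_fps :: "real fps" where
  "Gamma_fps = Abs_fps (\<lambda>l. Gamma_deriv l / fact l)"

definition Digamma_fps :: "real fps" where
  "Digamma_fps = Abs_fps (\<lambda>i. Polygamma i 1 / fact i)"

lemma Gamma_fps_nth_0 [simp]: "fps_nth Gamma_fps 0 = 1"
  by (simp add: Gamma_fps_def Gamma_deriv_def)

text \<open>Division by l! turns the binomial recursion for the derivatives at 1 into a Cauchy
  product: the formal version of Gamma' = Gamma * psi.\<close>

lemma fps_deriv_Gamma_fps: "fps_deriv Gamma_fps = Gamma_fps * Digamma_fps"
proof (rule fps_ext)
  fix l
  have "fps_nth (fps_deriv Gamma_fps) l = Gamma_deriv (Suc l) / fact l"
    using of_nat_neq_0[of l, where ?'a = real] by (simp add: Gamma_fps_def del: of_nat_Suc)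
  also have "\<dots> = (\<Sum>i\<le>l. fps_nth Digamma_fps i * fps_nth Gamma_fps (l - i))"
    unfolding Gamma_deriv_Suc sum_divide_distrib
    by (intro sum.cong) (auto simp: binomial_fact Gamma_fps_def Digamma_fps_def)
  also have "\<dots> = fps_nth (Gamma_fps * Digamma_fps) l"
    by (simp add: fps_mult_nth atLeast0AtMost mult.commute[of Gamma_fps])
  finally show "fps_nth (fps_deriv Gamma_fps) l = fps_nth (Gamma_fps * Digamma_fps) l" .
qed

section \<open>Euler's product for the Gamma function as a formal limit\<close>

text \<open>The lower end \<open>k\<close> is kept variable because one direction of the equivalence
  removes only the factors beyond \<open>k\<close>.\<close>

definition Euler_prod :: "nat \<Rightarrow> nat \<Rightarrow> real fps" where
  "Euler_prod k N = (\<Prod>j\<in>{k<..N}. 1 + fps_const (1 / real j) * fps_X)"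

text \<open>The reciprocal of Euler's approximation N^s / ((1 + s/1) ... (1 + s/N)) to Gamma(1 + s),
  as a series in s.\<close>

definition Euler_fps :: "nat \<Rightarrow> real fps" where
  "Euler_fps N = fps_exp (- ln (real N)) * Euler_prod 0 N"

text \<open>The summand for j is the geometric expansion of 1/(j + s), the logarithmic derivative of
  1 + s/j.\<close>

definition Euler_log_deriv :: "nat \<Rightarrow> real fps" where
  "Euler_log_deriv N = fps_const (- ln (real N)) +
     (\<Sum>j\<in>{0<..N}. Abs_fps (\<lambda>i. (- 1) ^ i / real j ^ Suc i))"

lemma fps_nth_0_prod: "fps_nth (prod F A) 0 = (\<Prod>x\<in>A. fps_nth (F x) 0)"
  for F :: "'a \<Rightarrow> 'b::comm_ring_1 fps"
  by (induction A rule: infinite_finite_induct) (simp_all add: fps_mult_nth_0)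

lemma Euler_prod_nth_0 [simp]: "fps_nth (Euler_prod k N) 0 = 1"
  by (simp add: Euler_prod_def fps_nth_0_prod)

lemma Euler_fps_nth_0 [simp]: "fps_nth (Euler_fps N) 0 = 1"
  by (simp add: Euler_fps_def)

lemma Euler_prod_self [simp]: "Euler_prod k k = 1"
  by (simp add: Euler_prod_def)

lemma Euler_prod_Suc:
  "k \<le> N \<Longrightarrow> Euler_prod k (Suc N) = (1 + fps_const (1 / real (Suc N)) * fps_X) * Euler_prod k N"
proof -
  assume "k \<le> N"
  then have "{k<..Suc N} = insert (Suc N) {k<..N}" by auto
  then show ?thesis by (simp add: Euler_prod_def)
qed

lemma Euler_prod_split: "k \<le> N \<Longrightarrow> Euler_prod 0 k * Euler_prod k N = Euler_prod 0 N"
  by (induction N rule: dec_induct) (simp_all add: Euler_prod_Suc mult_ac del: of_nat_Suc)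

lemma linear_mult_log_deriv:
  fixes c :: real
  assumes "c \<noteq> 0"
  shows "(1 + fps_const (1 / c) * fps_X) * Abs_fps (\<lambda>i. (- 1) ^ i / c ^ Suc i) = fps_const (1 / c)"
proof (rule fps_ext)
  fix i
  show "fps_nth ((1 + fps_const (1 / c) * fps_X) * Abs_fps (\<lambda>i. (- 1) ^ i / c ^ Suc i)) i =
      fps_nth (fps_const (1 / c)) i"
    using assms by (cases i) (auto simp: distrib_right mult.assoc field_simps)
qed

lemma fps_deriv_Euler_fps: "fps_deriv (Euler_fps N) = Euler_fps N * Euler_log_deriv N"
proof -
  let ?L = "\<lambda>j. Abs_fps (\<lambda>i. (- 1) ^ i / real j ^ Suc i)"
  have "fps_deriv (Euler_prod 0 N) = Euler_prod 0 N * (\<Sum>j\<in>{0<..N}. ?L j)"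
  proof (induction N)
    case (Suc N)
    have "{0<..Suc N} = insert (Suc N) {0<..N}" by auto
    then have "(\<Sum>j\<in>{0<..Suc N}. ?L j) = ?L (Suc N) + (\<Sum>j\<in>{0<..N}. ?L j)" by simp
    moreover have "fps_deriv (1 + fps_const (1 / real (Suc N)) * fps_X) =
        (1 + fps_const (1 / real (Suc N)) * fps_X) * ?L (Suc N)"
      by (subst linear_mult_log_deriv) auto
    ultimately show ?case
      unfolding Euler_prod_Suc[OF le0] fps_deriv_mult Suc.IH by (simp only: algebra_simps)
  qed simp
  then show ?thesis
    by (simp add: Euler_fps_def Euler_log_deriv_def fps_deriv_mult algebra_simps)
qed

text \<open>The constant coefficient is a harmonic sum minus ln N, with limit -psi(1). The higher
  ones are, up to sign, partial sums of the series for the polygamma values at 1.\<close>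

lemma Euler_log_deriv_tendsto:
  "(\<lambda>N. fps_nth (Euler_log_deriv N) i) \<longlonglongrightarrow> fps_nth (- Digamma_fps) i"
proof -
  have nth: "fps_nth (Euler_log_deriv N) i =
      (if i = 0 then - ln (real N) else 0) + (- 1) ^ i * (\<Sum>j<N. inverse ((1 + real j) ^ Suc i))" for N
  proof -
    have "(\<Sum>j\<in>{0<..N}. (- 1) ^ i / real j ^ Suc i) = (\<Sum>j<N. (- 1) ^ i / real (Suc j) ^ Suc i)"
      by (rule sum.reindex_bij_witness[of _ Suc "\<lambda>j. j - 1"]) auto
    then show ?thesis
      by (simp add: Euler_log_deriv_def fps_sum_nth sum_distrib_left field_simps)
  qed
  show ?thesis
  proof (cases "i = 0")
    case True
    have "(\<lambda>N. - (ln (real N) - (\<Sum>j<N. inverse (1 + real j)))) \<longlonglongrightarrow> - Digamma 1"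
      using Digamma_LIMSEQ[of "1 :: real"] by (intro tendsto_minus) simp
    then show ?thesis unfolding nth using True by (simp add: Digamma_fps_def)
  next
    case False
    have "(\<lambda>N. \<Sum>j<N. inverse ((1 + real j) ^ Suc i)) \<longlonglongrightarrow> (- 1) ^ Suc i * Polygamma i 1 / fact i"
      using Polygamma_LIMSEQ[of "1 :: real" i] False by (simp add: sums_def)
    from tendsto_mult[OF tendsto_const this, of "(- 1) ^ i"]
    show ?thesis unfolding nth using False
      by (simp add: Digamma_fps_def mult.assoc[symmetric] power_mult_distrib[symmetric])
  qed
qed

lemma fps_deriv_inverse_log_deriv:
  fixes A :: "real fps"
  assumes "fps_deriv A = A * L" "fps_nth A 0 = 1"
  shows "fps_deriv (inverse A) = inverse A * (- L)"
  using assms inverse_mult_eq_1'[of A]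
  by (simp add: fps_inverse_deriv power2_eq_square mult_ac)

lemma Euler_fps_tendsto:
  "(\<lambda>N. fps_nth (Euler_fps N) i) \<longlonglongrightarrow> fps_nth (inverse Gamma_fps) i"
  by (rule fps_tendsto_if_log_deriv_tendsto[OF fps_deriv_Euler_fps _
        fps_deriv_inverse_log_deriv[OF fps_deriv_Gamma_fps] _ Euler_log_deriv_tendsto]) auto

text \<open>Inversion flips the sign of the logarithmic derivative, so the same coefficient
  recursion applies to the reciprocals.\<close>

lemma inverse_Euler_fps_tendsto:
  "(\<lambda>N. fps_nth (inverse (Euler_fps N)) i) \<longlonglongrightarrow> fps_nth Gamma_fps i"
  by (rule fps_tendsto_if_log_deriv_tendsto[OF fps_deriv_inverse_log_deriv[OF fps_deriv_Euler_fps] _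
        fps_deriv_Gamma_fps])
    (use tendsto_minus[OF Euler_log_deriv_tendsto] in auto)

text \<open>The factors are removed one at a time, the one with the largest index first, by
  \<open>nonneg_if_add_pderiv_nonneg\<close>.\<close>

lemma nonneg_if_Euler_prod_nonneg:
  assumes "k \<le> N" and "\<And>y. poly (fps_pderiv (Euler_prod k N) u) y \<ge> 0"
  shows "poly u y \<ge> 0"
  using assms
proof (induction N arbitrary: y rule: dec_induct)
  case (step N)
  have "poly (fps_pderiv (Euler_prod k N) u) z \<ge> 0" for z
    by (rule nonneg_if_add_pderiv_nonneg[of "1 / real (Suc N)"])
      (use step in \<open>simp_all add: Euler_prod_Suc fps_pderiv_mult fps_pderiv_linear\<close>)
  then show ?case by (rule step.IH)
qed simp

lemma Euler_prod_nonneg_iff: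
  "(\<forall>k y. poly (fps_pderiv (Euler_prod 0 k) (fps_pderiv Gamma_fps q)) y \<ge> 0) \<longleftrightarrow> (\<forall>y. poly q y \<ge> 0)"
proof safe
  fix y
  assume nonneg: "\<forall>k y. poly (fps_pderiv (Euler_prod 0 k) (fps_pderiv Gamma_fps q)) y \<ge> 0"
  have "(\<lambda>N. poly (fps_pderiv (Euler_fps N) (fps_pderiv Gamma_fps q)) y)
      \<longlonglongrightarrow> poly (fps_pderiv (inverse Gamma_fps) (fps_pderiv Gamma_fps q)) y"
    by (intro tendsto_poly_fps_pderiv Euler_fps_tendsto)
  also have "fps_pderiv (inverse Gamma_fps) (fps_pderiv Gamma_fps q) = q"
    by (simp add: fps_pderiv_mult[symmetric] inverse_mult_eq_1)
  finally have lim: "(\<lambda>N. poly (fps_pderiv (Euler_fps N) (fps_pderiv Gamma_fps q)) y) \<longlonglongrightarrow> poly q y" .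
  have "poly (fps_pderiv (Euler_fps N) (fps_pderiv Gamma_fps q)) y \<ge> 0" for N
    using nonneg by (simp add: Euler_fps_def fps_pderiv_mult poly_fps_pderiv_exp)
  then show "poly q y \<ge> 0"
    by (intro LIMSEQ_le_const[OF lim]) auto
next
  fix k y
  assume nonneg: "\<forall>y. poly q y \<ge> 0"
  \<comment> \<open>For N \<ge> k this is N^D divided by the factors with k < j \<le> N, applied to
    \<open>q\<close>; restoring those factors leaves a translate of \<open>q\<close>.\<close>
  let ?W = "\<lambda>N. fps_pderiv (inverse (Euler_fps N)) (fps_pderiv (Euler_prod 0 k) q)"
  have W: "poly (?W N) y \<ge> 0" if "k \<le> N" for N
  proof (rule nonneg_if_Euler_prod_nonneg[OF that])
    fix z
    have "Euler_prod k N * (inverse (Euler_fps N) * Euler_prod 0 k) =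
        inverse (fps_exp (- ln (real N))) * (inverse (Euler_prod 0 N) * Euler_prod 0 N)"
      by (simp add: Euler_prod_split[OF that, symmetric] Euler_fps_def fps_inverse_mult mult_ac)
    also have "\<dots> = fps_exp (ln (real N))"
      by (simp add: inverse_mult_eq_1 fps_exp_neg)
    finally show "poly (fps_pderiv (Euler_prod k N) (?W N)) z \<ge> 0"
      using nonneg by (simp add: fps_pderiv_mult[symmetric] poly_fps_pderiv_exp)
  qed
  have "(\<lambda>N. poly (?W N) y) \<longlonglongrightarrow> poly (fps_pderiv Gamma_fps (fps_pderiv (Euler_prod 0 k) q)) y"
    by (intro tendsto_poly_fps_pderiv inverse_Euler_fps_tendsto)
  also have "fps_pderiv Gamma_fps (fps_pderiv (Euler_prod 0 k) q) =
      fps_pderiv (Euler_prod 0 k) (fps_pderiv Gamma_fps q)"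
    by (simp add: fps_pderiv_mult[symmetric] mult.commute)
  finally show "poly (fps_pderiv (Euler_prod 0 k) (fps_pderiv Gamma_fps q)) y \<ge> 0"
    by (rule LIMSEQ_le_const) (use W in blast)
qed

section \<open>Derivatives of a polynomial in the logarithm over the identity\<close>

text \<open>Differentiating R(-ln x) / x^(k+1) gives -((k+1) R + R')(-ln x) / x^(k+2). Pulling out
  k+1 leaves the next factor 1 + D/(k+1) and completes the factorial.\<close>

lemma higher_deriv_poly_ln:
  fixes P :: "real poly"
  assumes f: "\<And>x. x > 0 \<Longrightarrow> f x = poly P (- ln x) / x" and "x > 0"
  defines "E \<equiv> \<lambda>k x. (- 1) ^ k * fact k * poly (fps_pderiv (Euler_prod 0 k) P) (- ln x) / x ^ Suc k"
  shows "(deriv ^^ k) f x = E k x"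
    and "((deriv ^^ k) f has_real_derivative E (Suc k) x) (at x)"
proof -
  have E: "(E k has_real_derivative E (Suc k) x) (at x)" if "x > 0" for k x
  proof -
    define R where "R = fps_pderiv (Euler_prod 0 k) P"
    have "fps_pderiv (Euler_prod 0 (Suc k)) P = R + Polynomial.smult (1 / real (Suc k)) (pderiv R)"
      by (simp only: Euler_prod_Suc[OF le0] fps_pderiv_mult fps_pderiv_linear R_def)
    moreover have "c * a * (b + 1 / c * d) = a * (c * b + d)" if "c \<noteq> 0" for a b c d :: real
      using that by (simp add: field_simps)
    from this[of "real (Suc k)" "fact k"]
    have "fact (Suc k) * poly (R + Polynomial.smult (1 / real (Suc k)) (pderiv R)) y =
        fact k * (real (Suc k) * poly R y + poly (pderiv R) y)" for y
      by (simp only: fact_Suc poly_add poly_smult of_nat_neq_0 not_False_eq_True of_nat_mult)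
    ultimately have "E (Suc k) x = (- 1) ^ Suc k * fact k *
        (real (Suc k) * poly R (- ln x) + poly (pderiv R) (- ln x)) / x ^ Suc (Suc k)"
      by (simp only: E_def mult.assoc)
    moreover have "(E k has_real_derivative (- 1) ^ Suc k * fact k *
        (real (Suc k) * poly R (- ln x) + poly (pderiv R) (- ln x)) / x ^ Suc (Suc k)) (at x)"
    proof -
      have "((\<lambda>x. poly R (- ln x)) has_real_derivative poly (pderiv R) (- ln x) * (- (1 / x))) (at x)"
        using that by (auto intro!: derivative_eq_intros)
      from DERIV_cmult[OF DERIV_divide[OF this DERIV_pow[of "Suc k"]], of "(- 1) ^ k * fact k"]
      show ?thesis
        unfolding E_def R_def[symmetric] using that
        by (rule_tac DERIV_cong[rotated]) (auto simp: field_simps)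
    qed
    ultimately show ?thesis by simp
  qed
  \<comment> \<open>The formula for \<open>f\<close> holds only on the positive reals; openness of
    this set transfers the derivatives of \<open>E\<close> to those of \<open>f\<close>.\<close>
  have "\<forall>x>0. (deriv ^^ k) f x = E k x \<and> ((deriv ^^ k) f has_real_derivative E (Suc k) x) (at x)" for k
  proof (induction k)
    case 0
    have "f x = E 0 x" if "x > 0" for x
      using that by (simp add: f E_def)
    then show ?case
      using has_field_derivative_transform_within_open[OF E[of _ 0], of _ "{0<..}" f] by auto
  next
    case (Suc k)
    then have "(deriv ^^ Suc k) f x = E (Suc k) x" if "x > 0" for x
      using that by (simp add: DERIV_imp_deriv)
    then show ?case
      using has_field_derivative_transform_within_open[OF E[of _ "Suc k"], of _ "{0<..}" "(deriv ^^ Suc k) f"]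
      by auto
  qed
  with \<open>x > 0\<close> show "(deriv ^^ k) f x = E k x"
    and "((deriv ^^ k) f has_real_derivative E (Suc k) x) (at x)" by auto
qed

text \<open>The signs cancel, k!/x^(k+1) is positive, and -ln maps the positive reals onto all
  reals.\<close>

lemma completely_monotone_poly_ln_iff:
  fixes P :: "real poly"
  assumes "\<And>x. x > 0 \<Longrightarrow> f x = poly P (- ln x) / x"
  shows "completely_monotone f \<longleftrightarrow> (\<forall>k y. poly (fps_pderiv (Euler_prod 0 k) P) y \<ge> 0)"
proof -
  note D = higher_deriv_poly_ln[of f P, OF assms]
  have "(deriv ^^ k) f differentiable_on {0<..}" for k
    unfolding differentiable_on_def real_differentiable_def
    using D(2)[of _ k] has_field_derivative_at_within by fastforce
  moreover have "(- 1) ^ k * (deriv ^^ k) f x \<ge> 0 \<longleftrightarrow>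
      poly (fps_pderiv (Euler_prod 0 k) P) (- ln x) \<ge> 0" if "x > 0" for k x
  proof -
    have "(- 1) ^ k * (deriv ^^ k) f x =
        fact k / x ^ Suc k * poly (fps_pderiv (Euler_prod 0 k) P) (- ln x)"
      using that by (simp add: D(1) mult.assoc[symmetric] power_mult_distrib[symmetric])
    moreover have "fact k / x ^ Suc k > 0" using that by simp
    ultimately show ?thesis by (metis mult_nonneg_nonneg less_imp_le zero_le_mult_iff not_le)
  qed
  ultimately have "completely_monotone f \<longleftrightarrow>
      (\<forall>k. \<forall>x>0. poly (fps_pderiv (Euler_prod 0 k) P) (- ln x) \<ge> 0)"
    by (simp add: completely_monotone_def)
  also have "\<dots> \<longleftrightarrow> (\<forall>k y. poly (fps_pderiv (Euler_prod 0 k) P) y \<ge> 0)"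
    by (metis exp_gt_zero ln_exp minus_minus)
  finally show ?thesis .
qed

section \<open>From the matrix to the operator, and the characterization\<close>

lemma degree_vec_poly_le: "degree (vec_poly n v) \<le> n"
  unfolding vec_poly_def by (intro degree_sum_le) (auto intro: order.trans[OF degree_monom_le])

lemma coeff_vec_poly: "k \<le> n \<Longrightarrow> coeff (vec_poly n v) k = v $ k"
  by (simp add: vec_poly_def coeff_sum)

text \<open>
  In the variable \<open>-y\<close> the matrix \<open>A\<close> acts as \<open>\<Gamma>(1 + D)\<close> with \<open>D = d/dy\<close>.
\<close>

lemma A_mat_eq_fps_pderiv:
  assumes "degree q \<le> n" "m \<le> n"
  shows "(A_mat n *\<^sub>v coeff_vec n q) $ m = (- 1) ^ m * coeff (fps_pderiv Gamma_fps q) m"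
proof -
  have "(A_mat n *\<^sub>v coeff_vec n q) $ m =
      (\<Sum>k\<in>{..n}. if m \<le> k then (- 1) ^ m * real (k choose m) * Gamma_deriv (k - m) * coeff q k else 0)"
    using assms by (simp add: A_mat_def coeff_vec_def scalar_prod_def atLeast0LessThan lessThan_Suc_atMost
        if_distrib[of "\<lambda>x. x * _"] cong: if_cong)
  also have "\<dots> = (\<Sum>k\<in>{m..n}. (- 1) ^ m * real (k choose m) * Gamma_deriv (k - m) * coeff q k)"
    by (rule sum.mono_neutral_cong_right) auto
  also have "\<dots> = (\<Sum>l\<le>n - m. (- 1) ^ m * real ((m + l) choose m) * Gamma_deriv l * coeff q (m + l))"
    by (rule sum.reindex_bij_witness[of _ "\<lambda>l. m + l" "\<lambda>k. k - m"]) (use assms in auto)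
  \<comment> \<open>The added terms involve coefficients beyond the degree of \<open>q\<close>; the
    range now matches \<open>fps_pderiv_altdef\<close>.\<close>
  also have "\<dots> = (\<Sum>l\<le>n. (- 1) ^ m * real ((m + l) choose m) * Gamma_deriv l * coeff q (m + l))"
    by (rule sum.mono_neutral_left) (use assms in \<open>auto intro!: coeff_eq_0\<close>)
  also have "\<dots> = (- 1) ^ m * coeff (fps_pderiv Gamma_fps q) m"
  proof -
    \<comment> \<open>This is the factor of the l-th derivative at y^m; with the 1/l! in
      \<open>Gamma_fps\<close> it becomes the binomial coefficient.\<close>
    have "pochhammer (1 + real m) l = fact (m + l) / fact m" for l
      using pochhammer_product'[of "1 :: real" m l] by (simp add: pochhammer_fact[symmetric])
    then show ?thesis
      unfolding fps_pderiv_altdef[OF assms(1)] coeff_sum sum_distrib_left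
      by (intro sum.cong refl)
        (simp add: Gamma_fps_def coeff_higher_pderiv binomial_fact add.commute mult_ac)
  qed
  finally show ?thesis .
qed

theorem theorem1p3:
  fixes n :: nat and p :: "real poly" and f :: "real \<Rightarrow> real"
  assumes "degree p \<le> n"
    and "\<And>x. x > 0 \<Longrightarrow> f x = poly p (ln x) / x"
  shows "Psd n = SOS n \<and>
    (completely_monotone f \<longleftrightarrow> vec_poly n (A_inv n *\<^sub>v coeff_vec n p) \<in> Psd n)"
proof -
  define P where "P = pcompose p [:0, -1:]"
  define v where "v = A_inv n *\<^sub>v coeff_vec n p"
  define q where "q = vec_poly n v"
  have v: "v \<in> carrier_vec (n + 1)"
    unfolding v_def using A_inv(1)[of n] by (rule mult_mat_vec_carrier) (simp add: coeff_vec_def)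
  have deg: "degree q \<le> n" by (simp add: q_def degree_vec_poly_le)
  have "coeff_vec n q = v"
    using v by (intro eq_vecI) (auto simp: coeff_vec_def q_def coeff_vec_poly)
  then have "A_mat n *\<^sub>v coeff_vec n q = (A_mat n * A_inv n) *\<^sub>v coeff_vec n p"
    unfolding v_def
    by (simp add: assoc_mult_mat_vec[OF A_mat_carrier A_inv(1)] coeff_vec_def)
  also have "\<dots> = coeff_vec n p"
    by (simp add: A_inv(2) coeff_vec_def)
  finally have A: "A_mat n *\<^sub>v coeff_vec n q = coeff_vec n p" .
  have "coeff (fps_pderiv Gamma_fps q) m = coeff P m" for m
  proof (cases "m \<le> n")
    case True
    have "(- 1) ^ m * coeff (fps_pderiv Gamma_fps q) m = coeff p m"
      using A_mat_eq_fps_pderiv[OF deg True] True unfolding A by (simp add: coeff_vec_def)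
    \<comment> \<open>A second sign cancels the one in the matrix and turns the coefficient of p(y)
      into that of p(-y).\<close>
    then have "(- 1) ^ m * ((- 1) ^ m * coeff (fps_pderiv Gamma_fps q) m) = (- 1) ^ m * coeff p m"
      by simp
    then show ?thesis
      by (simp add: P_def coeff_pcompose_linear mult.assoc[symmetric] power_mult_distrib[symmetric])
  next
    case False
    then show ?thesis
      using degree_fps_pderiv_le[of Gamma_fps q] deg assms(1)
      by (simp add: P_def coeff_pcompose_linear coeff_eq_0)
  qed
  then have P: "fps_pderiv Gamma_fps q = P" by (rule poly_eqI)
  have "completely_monotone f \<longleftrightarrow> (\<forall>k y. poly (fps_pderiv (Euler_prod 0 k) P) y \<ge> 0)"
    by (rule completely_monotone_poly_ln_iff) (simp add: assms(2) P_def poly_pcompose)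
  also have "\<dots> \<longleftrightarrow> q \<in> Psd n"
    using deg by (simp add: P[symmetric] Euler_prod_nonneg_iff Psd_def)
  finally show ?thesis
    by (simp add: Psd_eq_SOS q_def v_def)
qed

end
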